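(* For every problem $f$, $f<_{\mathrm W}\mathsf{tJ}(f)$. Moreover, for all problems $f,g$, if $f\le_{\mathrm W} g$ then $\mathsf{tJ}(f)\le_{\mathrm W}\mathsf{tJ}(g)$.
   Context: A problem is a partial multi-valued function $f:\subseteq X\rightrightarrows Y$ between represented spaces $(X,\delta_X)$, $(Y,\delta_Y)$ (where $\delta_X:\subseteq\mathbb{N}^{\mathbb{N}}\to X$ and $\delta_Y:\subseteq\mathbb{N}^{\mathbb{N}}\to Y$ are partial surjections). Its realizer version is the problem on Baire space $f^r=\delta_Y^{-1}\circ f\circ\delta_X:\subseteq\mathbb{N}^{\mathbb{N}}\rightrightarrows\mathbb{N}^{\mathbb{N}}$; for a problem on Baire space (represented by the identity), $f^r=f$. For multi-valued $f$ on $\mathbb{N}^{\mathbb{N}}$, $\mathrm{dom}(f)=\{p:f(p)\neq\emptyset\}$. For problems on Baire space, $f\le_{\mathrm W} g$ means there are partial computable functionals $\Phi:\subseteq\mathbb{N}^{\mathbb{N}}\to\mathbb{N}^{\mathbb{N}}$ and $\Psi:\subseteq\mathbb{N}^{\mathbb{N}}\times\mathbb{N}^{\mathbb{N}}\to\mathbb{N}^{\mathbb{N}}$ such that for every $p\in\mathrm{dom}(f)$: $\Phi(p)\in\mathrm{dom}(g)$ and $\Psi(p,q)\in f(p)$ for every $q\in g(\Phi(p))$; in general $f\le_{\mathrm W} g$ means $f^r\le_{\mathrm W} g^r$. $f<_{\mathrm W} g$ means $f\le_{\mathrm W} g$ and $g\not\le_{\mathrm W} f$. Finite products of copies of $\mathbb{N}$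 and $\mathbb{N}^{\mathbb{N}}$ are identified with $\mathbb{N}^{\mathbb{N}}$ via standard computable codings. $(\Phi_e)_{e\in\mathbb{N}}$ is a fixed standard computable enumeration of the partial computable functionals on $\mathbb{N}^{\mathbb{N}}$; $\Phi_i(p,q)$ means $\Phi_i$ applied to the pair $(p,q)$; $\downarrow$ means defined. Tot-jump: for $f:\subseteq\mathbb{N}^{\mathbb{N}}\rightrightarrows\mathbb{N}^{\mathbb{N}}$, $e,i\in\mathbb{N}$, $p\in\mathbb{N}^{\mathbb{N}}$, $\mathsf{tJ}(f)(e,i,p)=\{\Phi_i(p,q): q\in f(\Phi_e(p))\}$ if $\Phi_e(p)\in\mathrm{dom}(f)$ and $\Phi_i(p,q)\downarrow$ for all $q\in f(\Phi_e(p))$; otherwise $\mathsf{tJ}(f)(e,i,p)=\mathbb{N}^{\mathbb{N}}$. For a problem $f$ on represented spaces, $\mathsf{tJ}(f)=\mathsf{tJ}(f^r)$. The ambient theory is ZFC. *)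

theory Defs
  imports Main "HOL-Library.Nat_Bijection"
begin

type_synonym baire = "nat \<Rightarrow> nat"

text \<open>
  Programs for the unary partial recursive functions relative to an oracle (Kleene's
  schemes: initial functions, composition, primitive recursion, unbounded search), where
  several arguments are passed as one number via Cantor pairing.
\<close>

datatype code =
    Zero
  | Succ
  | First
  | Second
  | Oracle
  | Tuple code code
  | Comp code code
  | Primrec code code
  | Mu code

primrec eval :: "code \<Rightarrow> baire \<Rightarrow> nat \<Rightarrow> nat option" where
  "eval Zero p n = Some 0"
| "eval Succ p n = Some (Suc n)"
| "eval First p n = Some (fst (prod_decode n))"
| "eval Second p n = Some (snd (prod_decode n))"
| "eval Oracle p n = Some (p n)"
| "eval (Tuple c d) p n =
     Option.bind (eval c p n) (\<lambda>a. Option.bind (eval d p n) (\<lambda>b. Some (prod_encode (a, b))))"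
| "eval (Comp c d) p n = Option.bind (eval d p n) (eval c p)"
| "eval (Primrec c d) p n =
     (let (a, k) = prod_decode n in
      rec_nat (eval c p a)
        (\<lambda>j r. Option.bind r (\<lambda>v. eval d p (prod_encode (a, prod_encode (j, v))))) k)"
| "eval (Mu c) p n =
     (if \<exists>k. eval c p (prod_encode (n, k)) = Some 0 \<and>
             (\<forall>j<k. eval c p (prod_encode (n, j)) \<noteq> None)
      then Some (LEAST k. eval c p (prod_encode (n, k)) = Some 0)
      else None)"

text \<open>The functional of a program is defined on exactly those oracles relative to which the
  program computes a total function.\<close>

definition functional :: "code \<Rightarrow> baire \<Rightarrow> baire option" where
  "functional c p =
     (if \<forall>n. eval c p n \<noteq> None then Some (\<lambda>n. the (eval c p n)) else None)"

definition computable_functional :: "(baire \<Rightarrow> baire option) \<Rightarrow> bool" where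
  "computable_functional F \<longleftrightarrow> (\<exists>c. F = functional c)"

lemma decode_less:
  assumes "\<not> n < (5::nat)"
  shows "(n - 5) div 4 < n" "fst (prod_decode ((n - 5) div 4)) < n"
    "snd (prod_decode ((n - 5) div 4)) < n"
proof -
  show 1: "(n - 5) div 4 < n" using assms by simp
  show "fst (prod_decode ((n - 5) div 4)) < n" "snd (prod_decode ((n - 5) div 4)) < n"
    using 1 le_prod_encode_1[of "fst (prod_decode ((n - 5) div 4))" "snd (prod_decode ((n - 5) div 4))"]
      le_prod_encode_2[of "snd (prod_decode ((n - 5) div 4))" "fst (prod_decode ((n - 5) div 4))"]
    by simp_all
qed

text \<open>Goedel numbering of the programs; it is a bijection, see below.\<close>

function decode :: "nat \<Rightarrow> code" where
  "decode n =
     (if n < 5 then [Zero, Succ, First, Second, Oracle] ! n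
      else let m = (n - 5) div 4; r = (n - 5) mod 4;
               a = fst (prod_decode m); b = snd (prod_decode m) in
        if r = 0 then Tuple (decode a) (decode b)
        else if r = 1 then Comp (decode a) (decode b)
        else if r = 2 then Primrec (decode a) (decode b)
        else Mu (decode m))"
  by pat_completeness auto
termination
  by (relation "measure id") (use decode_less in auto)

declare decode.simps [simp del]

primrec encode :: "code \<Rightarrow> nat" where
  "encode Zero = 0"
| "encode Succ = 1"
| "encode First = 2"
| "encode Second = 3"
| "encode Oracle = 4"
| "encode (Tuple c d) = 4 * prod_encode (encode c, encode d) + 5"
| "encode (Comp c d) = 4 * prod_encode (encode c, encode d) + 6"
| "encode (Primrec c d) = 4 * prod_encode (encode c, encode d) + 7"
| "encode (Mu c) = 4 * encode c + 8"

lemma div_mod_4: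
  fixes m :: nat
  shows "(4 * m + 6 - 5) div 4 = m" "(4 * m + 6 - 5) mod 4 = 1"
    "(4 * m + 7 - 5) div 4 = m" "(4 * m + 7 - 5) mod 4 = 2"
    "(4 * m + 8 - 5) div 4 = m" "(4 * m + 8 - 5) mod 4 = 3"
proof -
  have eq: "4 * m + 6 - 5 = 4 * m + 1" "4 * m + 7 - 5 = 4 * m + 2" "4 * m + 8 - 5 = 4 * m + 3"
    by simp_all
  have *: "(4 * m + k) div 4 = m" "(4 * m + k) mod 4 = k" if "k < 4" for k :: nat
    using that by simp_all
  show "(4 * m + 6 - 5) div 4 = m" "(4 * m + 6 - 5) mod 4 = 1"
    "(4 * m + 7 - 5) div 4 = m" "(4 * m + 7 - 5) mod 4 = 2"
    "(4 * m + 8 - 5) div 4 = m" "(4 * m + 8 - 5) mod 4 = 3"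
    unfolding eq by (rule *; simp)+
qed

lemma decode_small:
  "decode 0 = Zero" "decode 1 = Succ" "decode 2 = First" "decode 3 = Second" "decode 4 = Oracle"
  by (subst decode.simps, simp)+

lemma decode_large:
  "decode (4 * prod_encode (a, b) + 5) = Tuple (decode a) (decode b)"
  "decode (4 * prod_encode (a, b) + 6) = Comp (decode a) (decode b)"
  "decode (4 * prod_encode (a, b) + 7) = Primrec (decode a) (decode b)"
  "decode (4 * m + 8) = Mu (decode m)"
  by (simp_all only: decode.simps[of "4 * prod_encode (a, b) + 5"]
      decode.simps[of "4 * prod_encode (a, b) + 6"]
      decode.simps[of "4 * prod_encode (a, b) + 7"]
      decode.simps[of "4 * m + 8"] Let_def div_mod_4) simp_all

lemma decode_encode [simp]: "decode (encode c) = c"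
  by (induction c) (simp_all only: encode.simps decode_small decode_large)

lemma encode_decode [simp]: "encode (decode n) = n"
proof (induction n rule: less_induct)
  case (less n)
  show ?case
  proof (cases "n < 5")
    case True
    then have "n = 0 \<or> n = 1 \<or> n = 2 \<or> n = 3 \<or> n = 4" by auto
    then show ?thesis by (elim disjE) (simp_all only: decode_small encode.simps)
  next
    case False
    define m a b where "m = (n - 5) div 4" and "a = fst (prod_decode m)" and "b = snd (prod_decode m)"
    have ab: "m = prod_encode (a, b)" by (simp add: a_def b_def)
    have IH: "encode (decode m) = m" "encode (decode a) = a" "encode (decode b) = b"
      using less decode_less[OF False] unfolding m_def a_def b_def by blast+
    have "n = 4 * m + 5 \<or> n = 4 * m + 6 \<or> n = 4 * m + 7 \<or> n = 4 * m + 8"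
    proof -
      have "n - 5 = 4 * m + (n - 5) mod 4" unfolding m_def by (rule mult_div_mod_eq[symmetric])
      moreover have "(n - 5) mod 4 < 4" by simp
      ultimately show ?thesis using False by linarith
    qed
    then show ?thesis
    proof (elim disjE)
      assume "n = 4 * m + 8"
      then show ?thesis by (simp only: decode_large encode.simps IH)
    qed (simp_all only: ab decode_large encode.simps IH)
  qed
qed

definition Phi :: "nat \<Rightarrow> baire \<Rightarrow> baire option" where
  "Phi e = functional (decode e)"

lemma computable_functional_iff_Phi: "computable_functional F \<longleftrightarrow> (\<exists>e. F = Phi e)"
  unfolding computable_functional_def Phi_def by (metis decode_encode)

text \<open>Codings of \<open>\<nat>\<^sup>\<nat> \<times> \<nat>\<^sup>\<nat>\<close> (interleaving) and \<open>\<nat> \<times> \<nat>\<^sup>\<nat>\<close> (prepending) into Baire space.\<close>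

definition join :: "baire \<Rightarrow> baire \<Rightarrow> baire" where
  "join p q n = (if even n then p (n div 2) else q (n div 2))"

definition prepend :: "nat \<Rightarrow> baire \<Rightarrow> baire" where
  "prepend k p = case_nat k p"

lemma bij_join: "bij (case_prod join)"
proof (rule o_bij)
  let ?s = "\<lambda>r. (\<lambda>n. r (2 * n), \<lambda>n. r (2 * n + 1))"
  show "?s \<circ> case_prod join = id"
    by (rule ext) (simp add: join_def split: prod.split)
  show "case_prod join \<circ> ?s = id"
    by (rule ext) (simp add: join_def fun_eq_iff)
qed

lemma bij_prepend: "bij (case_prod prepend)"
proof (rule o_bij)
  let ?s = "\<lambda>r. (r 0, \<lambda>n. r (Suc n))"
  show "?s \<circ> case_prod prepend = id"
    by (rule ext) (simp add: prepend_def split: prod.split)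
  show "case_prod prepend \<circ> ?s = id"
    by (rule ext) (simp add: prepend_def fun_eq_iff split: nat.split)
qed

record 'a repspace =
  points :: "'a set"
  rep :: "baire \<Rightarrow> 'a option"

definition represented_space :: "'a repspace \<Rightarrow> bool" where
  "represented_space X \<longleftrightarrow> ran (rep X) = points X"

definition baire_space :: "baire repspace" where
  "baire_space = \<lparr>points = UNIV, rep = Some\<rparr>"

text \<open>A partial multi-valued function is a set-valued function whose domain consists of the
  arguments with nonempty value.\<close>

record ('a, 'b) problem =
  source :: "'a repspace"
  target :: "'b repspace"
  sols :: "'a \<Rightarrow> 'b set"

definition is_problem :: "('a, 'b) problem \<Rightarrow> bool" where
  "is_problem f \<longleftrightarrow>
     represented_space (source f) \<and> represented_space (target f) \<and>
     (\<forall>x y. y \<in> sols f x \<longrightarrow> x \<in> points (source f) \<and> y \<in> points (target f))"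

definition mdom :: "('a \<Rightarrow> 'b set) \<Rightarrow> 'a set" where
  "mdom F = {x. F x \<noteq> {}}"

definition realizer :: "('a, 'b) problem \<Rightarrow> baire \<Rightarrow> baire set" where
  "realizer f p = {q. \<exists>x y. rep (source f) p = Some x \<and> y \<in> sols f x \<and> rep (target f) q = Some y}"

definition baire_problem :: "(baire \<Rightarrow> baire set) \<Rightarrow> (baire, baire) problem" where
  "baire_problem F = \<lparr>source = baire_space, target = baire_space, sols = F\<rparr>"

lemma is_problem_baire_problem: "is_problem (baire_problem F)"
  by (auto simp: is_problem_def baire_problem_def baire_space_def represented_space_def ran_def)

lemma realizer_baire_problem: "realizer (baire_problem F) = F"
  by (rule ext) (auto simp: realizer_def baire_problem_def baire_space_def)

definition weihrauch_baire :: "(baire \<Rightarrow> baire set) \<Rightarrow> (baire \<Rightarrow> baire set) \<Rightarrow> bool" where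
  "weihrauch_baire F G \<longleftrightarrow>
     (\<exists>\<Phi> \<Psi>. computable_functional \<Phi> \<and> computable_functional \<Psi> \<and>
       (\<forall>p\<in>mdom F. \<exists>p'. \<Phi> p = Some p' \<and> p' \<in> mdom G \<and>
         (\<forall>q\<in>G p'. \<exists>r. \<Psi> (join p q) = Some r \<and> r \<in> F p)))"

definition weihrauch_le :: "('a, 'b) problem \<Rightarrow> ('c, 'd) problem \<Rightarrow> bool"
    (infix \<open>\<le>\<^sub>W\<close> 50) where
  "f \<le>\<^sub>W g \<longleftrightarrow> weihrauch_baire (realizer f) (realizer g)"

definition weihrauch_less :: "('a, 'b) problem \<Rightarrow> ('c, 'd) problem \<Rightarrow> bool"
    (infix \<open><\<^sub>W\<close> 50) where
  "f <\<^sub>W g \<longleftrightarrow> f \<le>\<^sub>W g \<and> \<not> g \<le>\<^sub>W f"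

definition tot_jump_at :: "(baire \<Rightarrow> baire set) \<Rightarrow> nat \<Rightarrow> nat \<Rightarrow> baire \<Rightarrow> baire set" where
  "tot_jump_at F e i p =
     (if \<exists>p'. Phi e p = Some p' \<and> p' \<in> mdom F \<and> (\<forall>q\<in>F p'. Phi i (join p q) \<noteq> None)
      then {the (Phi i (join p q)) | q. q \<in> F (the (Phi e p))}
      else UNIV)"

text \<open>An instance \<open>(e, i, p)\<close> is coded as \<open>prepend e (prepend i p)\<close>; since \<open>prepend\<close> is
  bijective, the union below ranges over exactly one triple.\<close>

definition tot_jump_baire :: "(baire \<Rightarrow> baire set) \<Rightarrow> baire \<Rightarrow> baire set" where
  "tot_jump_baire F r = \<Union>{tot_jump_at F e i p | e i p. r = prepend e (prepend i p)}"

lemma tot_jump_baire_prepend [simp]: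
  "tot_jump_baire F (prepend e (prepend i p)) = tot_jump_at F e i p"
proof -
  have *: "prepend k p = prepend k' p' \<longleftrightarrow> k = k' \<and> p = p'" for k p k' p'
    using inj_eq[OF bij_is_inj[OF bij_prepend], of "(k, p)" "(k', p')"] by simp
  show ?thesis unfolding tot_jump_baire_def * by blast
qed

definition tot_jump :: "('a, 'b) problem \<Rightarrow> (baire, baire) problem" where
  "tot_jump f = baire_problem (tot_jump_baire (realizer f))"

end

theory Submission imports Defs begin

text \<open>
  Passing to realizers leaves three facts about multi-valued functions \<open>F\<close> and \<open>G\<close> on Baire space.

  The reduction of \<open>F\<close> to its jump asks the jump for \<open>F\<close> itself: take for \<open>e\<close> an index of the
  identity and for \<open>i\<close> an index of the projection of \<open>(p, q)\<close> to \<open>q\<close>.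

  The jump does not reduce to \<open>F\<close>, by diagonalization (\<open>not_weihrauch_baire_tot_jump\<close>). Since the
  jump is total, a reduction \<open>\<Phi>, \<Psi>\<close> must handle every triple \<open>r = (e, i, p)\<close>. A suitable choice of
  \<open>r\<close> makes \<open>\<Phi>\<^sub>e(p) = \<Phi>(r)\<close> and makes \<open>\<Phi>\<^sub>i(p, q)\<close> the pointwise successor of
  \<open>\<Psi>(r, q)\<close>. The self-reference is arranged by a \<open>p\<close> that contains \<open>e\<close> and \<open>i\<close> as its
  first two values. The nonempty set \<open>A\<close> of all \<open>\<Psi>(r, q)\<close> with
  \<open>q \<in> F(\<Phi>(r))\<close> would then consist of pointwise successors of its own elements. It is not enough
  that each \<open>\<Psi>(r, q)\<close> differs from its own modification, as \<open>F\<close> is multi-valued; what makes the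
  successor work is that an element of \<open>A\<close> with least value at \<open>0\<close> cannot be such a successor.

  For monotonicity (\<open>weihrauch_baire_tot_jump_mono\<close>), let \<open>\<Phi>, \<Psi>\<close> reduce \<open>F\<close> to \<open>G\<close>. An instance
  \<open>(e, i, p)\<close> is sent to \<open>(e', i', p)\<close> with \<open>\<Phi>\<^sub>e\<^sub>'(p) = \<Phi>(\<Phi>\<^sub>e(p))\<close> and
  \<open>\<Phi>\<^sub>i\<^sub>'(p, q) = \<Phi>\<^sub>i(p, \<Psi>(\<Phi>\<^sub>e(p), q))\<close> whenever the inner values are
  defined, and answers are returned unchanged. If
  \<open>\<Phi>\<^sub>e(p)\<close> lies in the domain of \<open>F\<close> and \<open>\<Phi>\<^sub>i(p, q)\<close> is defined for all \<open>q \<in> F(\<Phi>\<^sub>e(p))\<close>, then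
  \<open>(e', i', p)\<close> has the same properties with respect to \<open>G\<close>, and its answers are among those of
  \<open>(e, i, p)\<close>; otherwise every answer to \<open>(e, i, p)\<close> is correct. The
  point is that \<open>e'\<close> and \<open>i'\<close> are computable from \<open>e\<close> and \<open>i\<close>. A
  functional is composed with another by replacing the oracle in its program, so it suffices that this
  syntactic substitution is computable on program numbers (\<open>total_computable_osubst\<close>): it is a
  course-of-values recursion along the numbering.
\<close>

section \<open>Total computable operators\<close>

definition total_computable :: "(baire \<Rightarrow> baire) \<Rightarrow> bool" where
  "total_computable F \<longleftrightarrow> computable_functional (\<lambda>p. Some (F p))"

lemma functional_eq_Some_iff:
  "functional c p = Some f \<longleftrightarrow> (\<forall>n. eval c p n = Some (f n))"
proof
  show "\<forall>n. eval c p n = Some (f n)" if "functional c p = Some f"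
    using that by (auto simp: functional_def split: if_splits)
qed (simp add: functional_def)

lemma total_computable_iff_eval:
  "total_computable F \<longleftrightarrow> (\<exists>c. \<forall>p n. eval c p n = Some (F p n))"
  unfolding total_computable_def computable_functional_def fun_eq_iff
  by (metis functional_eq_Some_iff)

lemma total_computable_id: "total_computable (\<lambda>p n. n)"
  unfolding total_computable_iff_eval by (rule exI[of _ "Tuple First Second"]) simp

lemma total_computable_compose:
  assumes "total_computable F" "total_computable G"
  shows "total_computable (\<lambda>p n. F p (G p n))"
proof -
  obtain c d where "\<And>p n. eval c p n = Some (F p n)" "\<And>p n. eval d p n = Some (G p n)"
    using assms unfolding total_computable_iff_eval by blast
  then show ?thesis unfolding total_computable_iff_eval by (intro exI[of _ "Comp c d"]) simp
qed

lemma total_computable_Suc: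
  assumes "total_computable F"
  shows "total_computable (\<lambda>p n. Suc (F p n))"
proof (rule total_computable_compose[OF _ assms])
  show "total_computable (\<lambda>p. Suc)"
    unfolding total_computable_iff_eval by (rule exI[of _ Succ]) simp
qed

lemma total_computable_oracle:
  assumes "total_computable F"
  shows "total_computable (\<lambda>p n. p (F p n))"
proof (rule total_computable_compose[OF _ assms])
  show "total_computable (\<lambda>p. p)"
    unfolding total_computable_iff_eval by (rule exI[of _ Oracle]) simp
qed

lemma total_computable_const: "total_computable (\<lambda>p n. k)"
proof (induction k)
  case 0
  show ?case unfolding total_computable_iff_eval by (rule exI[of _ Zero]) simp
next
  case (Suc k)
  then show ?case by (rule total_computable_Suc)
qed

lemma total_computable_pair:
  assumes "total_computable F" "total_computable G"
  shows "total_computable (\<lambda>p n. prod_encode (F p n, G p n))"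
proof -
  obtain c d where "\<And>p n. eval c p n = Some (F p n)" "\<And>p n. eval d p n = Some (G p n)"
    using assms unfolding total_computable_iff_eval by blast
  then show ?thesis unfolding total_computable_iff_eval by (intro exI[of _ "Tuple c d"]) simp
qed

abbreviation left :: "nat \<Rightarrow> nat" where "left n \<equiv> fst (prod_decode n)"
abbreviation right :: "nat \<Rightarrow> nat" where "right n \<equiv> snd (prod_decode n)"

lemma total_computable_left:
  assumes "total_computable F"
  shows "total_computable (\<lambda>p n. left (F p n))"
proof (rule total_computable_compose[OF _ assms])
  show "total_computable (\<lambda>p n. left n)"
    unfolding total_computable_iff_eval by (rule exI[of _ First]) simp
qed

lemma total_computable_right:
  assumes "total_computable F"
  shows "total_computable (\<lambda>p n. right (F p n))"
proof (rule total_computable_compose[OF _ assms])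
  show "total_computable (\<lambda>p n. right n)"
    unfolding total_computable_iff_eval by (rule exI[of _ Second]) simp
qed

text \<open>The step takes the parameter \<open>n\<close>, the counter and the previous value, which a program can
  only receive packed into one number \<open>x\<close>. With the projections of \<open>x\<close> spelled out, backward
  application of the rule yields again a goal about a function of one number, so that the
  closure rules can be applied by following the syntax of a term.\<close>

lemma total_computable_rec_nat:
  assumes "total_computable A" "total_computable K"
    "total_computable (\<lambda>p x. D p (left x) (left (right x)) (right (right x)))"
  shows "total_computable (\<lambda>p n. rec_nat (A p n) (D p n) (K p n))"
proof -
  obtain a k d where
    a: "\<And>p n. eval a p n = Some (A p n)" and k: "\<And>p n. eval k p n = Some (K p n)" and
    d: "\<And>p x. eval d p x = Some (D p (left x) (left (right x)) (right (right x)))"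
    using assms unfolding total_computable_iff_eval by metis
  have "rec_nat (eval a p n)
      (\<lambda>j r. Option.bind r (\<lambda>v. eval d p (prod_encode (n, prod_encode (j, v))))) m =
      Some (rec_nat (A p n) (D p n) m)" for p n m
    by (induction m) (simp_all add: a d)
  then show ?thesis unfolding total_computable_iff_eval
    by (intro exI[of _ "Comp (Primrec a d) (Tuple (Tuple First Second) k)"]) (simp add: k)
qed

lemma total_computable_case_nat:
  assumes "total_computable A" "total_computable K"
    "total_computable (\<lambda>p x. B p (left x) (right x))"
  shows "total_computable (\<lambda>p n. case_nat (A p n) (B p n) (K p n))"
proof -
  have "total_computable (\<lambda>p n. rec_nat (A p n) (\<lambda>j v. B p n j) (K p n))"
  proof (rule total_computable_rec_nat[OF assms(1,2)])
    show "total_computable (\<lambda>p x. B p (left x) (left (right x)))"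
      using total_computable_compose[OF assms(3), of "\<lambda>p x. prod_encode (left x, left (right x))"]
      by (simp add: total_computable_pair total_computable_left total_computable_right
          total_computable_id)
  qed
  moreover have "rec_nat a (\<lambda>j v. b j) k = case_nat a b k" for a k :: nat and b
    by (cases k) simp_all
  ultimately show ?thesis by simp
qed

text \<open>Composition is left out here: its conclusion matches every term.\<close>

lemmas total_computable_basic =
  total_computable_id total_computable_const total_computable_Suc total_computable_pair
  total_computable_left total_computable_right

lemma total_computable_add:
  assumes "total_computable F" "total_computable G"
  shows "total_computable (\<lambda>p n. F p n + G p n)"
proof -
  have "total_computable (\<lambda>p n. rec_nat (F p n) (\<lambda>j v. Suc v) (G p n))"
    by (rule total_computable_rec_nat[OF assms]) (intro total_computable_basic)
  moreover have "rec_nat a (\<lambda>j v. Suc v) b = a + b" for a b by (induction b) simp_all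
  ultimately show ?thesis by simp
qed

lemma total_computable_mult:
  assumes "total_computable F" "total_computable G"
  shows "total_computable (\<lambda>p n. F p n * G p n)"
proof -
  have "total_computable (\<lambda>p n. rec_nat 0 (\<lambda>j v. v + F p n) (G p n))"
  proof (rule total_computable_rec_nat[OF total_computable_const assms(2)])
    show "total_computable (\<lambda>p x. right (right x) + F p (left x))"
      by (intro total_computable_add total_computable_compose[OF assms(1)] total_computable_basic)
  qed
  moreover have "rec_nat 0 (\<lambda>j v. v + a) b = a * b" for a b :: nat by (induction b) simp_all
  ultimately show ?thesis by simp
qed

lemma total_computable_diff:
  assumes "total_computable F" "total_computable G"
  shows "total_computable (\<lambda>p n. F p n - G p n)"
proof -
  have "total_computable (\<lambda>p n. rec_nat (F p n) (\<lambda>j v. case v of 0 \<Rightarrow> 0 | Suc w \<Rightarrow> w) (G p n))"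
    by (rule total_computable_rec_nat[OF assms])
      (intro total_computable_case_nat total_computable_basic)
  moreover have "rec_nat a (\<lambda>j v. case v of 0 \<Rightarrow> 0 | Suc w \<Rightarrow> w) b = a - b" for a b :: nat
    by (induction b) (auto split: nat.split)
  ultimately show ?thesis by simp
qed

lemma total_computable_if_eq:
  assumes "total_computable F" "total_computable G" "total_computable A" "total_computable B"
  shows "total_computable (\<lambda>p n. if F p n = G p n then A p n else B p n)"
proof -
  have "total_computable (\<lambda>p n. case (F p n - G p n) + (G p n - F p n) of 0 \<Rightarrow> A p n | Suc j \<Rightarrow> B p n)"
    by (intro total_computable_case_nat total_computable_add total_computable_diff
        total_computable_compose[OF assms(4)] total_computable_basic assms)
  \<comment> \<open>truncated subtraction turns equality into a test for zero\<close>
  moreover have "(case (a - b) + (b - a) of 0 \<Rightarrow> x | Suc j \<Rightarrow> y) = (if a = b then x else y)"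
    for a b x y :: nat
    by (auto split: nat.split)
  ultimately show ?thesis by simp
qed

lemma total_computable_mod_const:
  assumes "total_computable F"
  shows "total_computable (\<lambda>p n. F p n mod k)"
proof -
  have "total_computable (\<lambda>p n. rec_nat 0 (\<lambda>j v. if Suc v = k then 0 else Suc v) (F p n))"
    by (rule total_computable_rec_nat[OF _ assms])
      (intro total_computable_if_eq total_computable_basic)+
  moreover have "rec_nat 0 (\<lambda>j v. if Suc v = k then 0 else Suc v) a = a mod k" for a
    by (induction a) (simp_all add: mod_Suc)
  ultimately show ?thesis by simp
qed

lemma total_computable_div_const:
  assumes "total_computable F"
  shows "total_computable (\<lambda>p n. F p n div k)"
proof -
  have "total_computable (\<lambda>p n. rec_nat 0 (\<lambda>j v. if Suc j mod k = 0 then Suc v else v) (F p n))"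
    by (rule total_computable_rec_nat[OF _ assms])
      (intro total_computable_if_eq total_computable_mod_const total_computable_basic)+
  moreover have "rec_nat 0 (\<lambda>j v. if Suc j mod k = 0 then Suc v else v) a = a div k" for a
    by (induction a) (simp_all add: div_Suc)
  ultimately show ?thesis by simp
qed

lemma total_computable_funpow_right:
  assumes "total_computable F" "total_computable K"
  shows "total_computable (\<lambda>p n. (right ^^ K p n) (F p n))"
proof -
  have "total_computable (\<lambda>p n. rec_nat (F p n) (\<lambda>j v. right v) (K p n))"
    by (rule total_computable_rec_nat[OF assms]) (intro total_computable_basic)
  moreover have "rec_nat a (\<lambda>j v. right v) b = (right ^^ b) a" for a b by (induction b) simp_all
  ultimately show ?thesis by simp
qed

lemmas total_computable_intros =
  total_computable_basic total_computable_oracle total_computable_case_nat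
  total_computable_add total_computable_mult total_computable_diff total_computable_if_eq
  total_computable_mod_const total_computable_div_const

lemma join_eq_if_mod: "join p q = (\<lambda>n. if n mod 2 = 0 then p (n div 2) else q (n div 2))"
  by (simp add: join_def fun_eq_iff even_iff_mod_2_eq_zero)

lemma total_computable_join:
  assumes "total_computable F" "total_computable G"
  shows "total_computable (\<lambda>p. join (F p) (G p))"
  unfolding join_eq_if_mod
  by (intro total_computable_if_eq total_computable_compose[OF assms(1)]
      total_computable_compose[OF assms(2)] total_computable_mod_const total_computable_div_const
      total_computable_basic)

lemma total_computable_prepend:
  assumes "total_computable (\<lambda>p n. k p)" "total_computable F"
  shows "total_computable (\<lambda>p. prepend (k p) (F p))"
proof -
  have "total_computable (\<lambda>p n. case_nat (k p) (F p) n)"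
    by (intro total_computable_case_nat total_computable_compose[OF assms(2)] assms(1)
        total_computable_basic)
  then show ?thesis by (simp add: prepend_def)
qed

lemma join_simps [simp]: "join p q (2 * n) = p n" "join p q (Suc (2 * n)) = q n"
  by (simp_all add: join_def)

lemma prepend_simps [simp]: "prepend k p 0 = k" "prepend k p (Suc n) = p n"
  by (simp_all add: prepend_def)

lemma prepend_head_tail: "prepend (r 0) (\<lambda>n. r (Suc n)) = r"
  by (simp add: prepend_def fun_eq_iff split: nat.split)

lemma total_computable_imp_Phi:
  assumes "total_computable F"
  shows "\<exists>e. \<forall>p. Phi e p = Some (F p)"
  using assms unfolding total_computable_def computable_functional_iff_Phi by metis

section \<open>Substituting a program for the oracle\<close>

text \<open>Composition of functionals at the level of programs. The number \<open>n\<close> and the oracle are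
  separate inputs of a program, so \<open>Comp\<close> does not provide it.\<close>

primrec osubst :: "code \<Rightarrow> code \<Rightarrow> code" where
  "osubst d Zero = Zero"
| "osubst d Succ = Succ"
| "osubst d First = First"
| "osubst d Second = Second"
| "osubst d Oracle = d"
| "osubst d (Tuple a b) = Tuple (osubst d a) (osubst d b)"
| "osubst d (Comp a b) = Comp (osubst d a) (osubst d b)"
| "osubst d (Primrec a b) = Primrec (osubst d a) (osubst d b)"
| "osubst d (Mu a) = Mu (osubst d a)"

text \<open>Totality of the inserted program on the oracle \<open>p\<close> makes each oracle query answered, so
  that the two runs agree step by step, including the places where they diverge.\<close>

lemma eval_osubst:
  assumes "functional d p = Some g"
  shows "eval (osubst d c) p = eval c g"
proof (induction c)
  case Oracle
  then show ?case using assms by (auto simp: functional_eq_Some_iff fun_eq_iff)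
qed (auto intro!: ext)

lemma functional_osubst:
  assumes "functional d p = Some g"
  shows "functional (osubst d c) p = functional c g"
  unfolding functional_def eval_osubst[OF assms] ..

lemma functional_Comp_Succ:
  assumes "functional c p = Some f"
  shows "functional (Comp Succ c) p = Some (\<lambda>n. Suc (f n))"
  using assms by (simp add: functional_eq_Some_iff)

text \<open>Carrying the list of all earlier values along turns a course-of-values recursion into a
  primitive one. The latest value is outermost, so \<open>f k\<close> lies below \<open>n - Suc k\<close> later ones.\<close>

primrec history :: "(nat \<Rightarrow> nat) \<Rightarrow> nat \<Rightarrow> nat" where
  "history f 0 = 0"
| "history f (Suc n) = prod_encode (f n, history f n)"

definition lookup :: "nat \<Rightarrow> nat \<Rightarrow> nat \<Rightarrow> nat" where
  "lookup n h k = left ((right ^^ (n - Suc k)) h)"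

lemma lookup_history:
  assumes "k < n"
  shows "lookup n (history f n) k = f k"
proof -
  have "(right ^^ m) (history f (m + j)) = history f j" for m j
    by (induction m) (simp_all add: funpow_Suc_right del: funpow.simps(2))
  from this[of "n - Suc k" "Suc k"] show ?thesis using assms by (simp add: lookup_def)
qed

text \<open>Substitution on program numbers: \<open>d\<close> is the number of the inserted program and \<open>h\<close> the
  history of the results for all numbers below \<open>n\<close>. The number \<open>4\<close> is that of \<open>Oracle\<close>, smaller
  numbers are the other initial functions, and the residue of \<open>n - 5\<close> modulo \<open>4\<close> tells the
  outermost constructor, residue \<open>3\<close> being the only one with a single subprogram.\<close>

definition osubst_step :: "nat \<Rightarrow> nat \<Rightarrow> nat \<Rightarrow> nat" where
  "osubst_step d n h =
     (if n - 4 = 0 then (if n = 4 then d else n)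
      else if (n - 5) mod 4 = 3 then 4 * lookup n h ((n - 5) div 4) + 8
      else 4 * prod_encode (lookup n h (left ((n - 5) div 4)), lookup n h (right ((n - 5) div 4)))
        + ((n - 5) mod 4 + 5))"

lemma encode_osubst_eq_step:
  "encode (osubst d (decode n)) =
     osubst_step (encode d) n (history (\<lambda>k. encode (osubst d (decode k))) n)"
proof -
  define s where "s k = encode (osubst d (decode k))" for k
  define m where "m = (n - 5) div 4"
  have s: "s (encode a) = encode (osubst d a)" for a by (simp add: s_def)
  have look: "lookup n (history s n) m = s m" "lookup n (history s n) (left m) = s (left m)"
    "lookup n (history s n) (right m) = s (right m)" if "\<not> n < 5"
    using decode_less[OF that] unfolding m_def by (auto intro: lookup_history)
  obtain c where n: "n = encode c" by (metis encode_decode)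
  have residues: "Suc (4 * k) div 4 = k" "Suc (4 * k) mod 4 = 1"
    "Suc (Suc (4 * k)) div 4 = k" "Suc (Suc (4 * k)) mod 4 = 2"
    "Suc (Suc (Suc (4 * k))) div 4 = k" "Suc (Suc (Suc (4 * k))) mod 4 = 3" for k :: nat
    by presburger+
  have "encode (osubst d c) = osubst_step (encode d) n (history s n)"
    using look unfolding osubst_step_def m_def n
    by (cases c) (simp_all add: s residues)
  then have "s n = osubst_step (encode d) n (history s n)" by (simp add: n s)
  then show ?thesis by (simp add: s_def[abs_def])
qed

text \<open>Both programs may depend on the argument. For monotonicity this matters, since the programs
  \<open>\<Phi>\<^sub>e\<close> and \<open>\<Phi>\<^sub>i\<close>, of which one is inserted and the other receives an insertion, are part
  of the instance.\<close>

lemma total_computable_osubst: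
  assumes "total_computable (\<lambda>p n. encode (D p n))" "total_computable (\<lambda>p n. encode (C p n))"
  shows "total_computable (\<lambda>p n. encode (osubst (D p n) (C p n)))"
proof -
  let ?h = "\<lambda>d m. rec_nat 0 (\<lambda>j h. prod_encode (osubst_step d j h, h)) m"
  have h: "?h (encode d) m = history (\<lambda>k. encode (osubst d (decode k))) m" for d m
    by (induction m) (simp_all add: encode_osubst_eq_step[symmetric])
  have "total_computable (\<lambda>p n. ?h (encode (D p n)) (Suc (encode (C p n))))"
    unfolding osubst_step_def lookup_def
    by (intro total_computable_rec_nat total_computable_funpow_right
        total_computable_compose[OF assms(1)] total_computable_intros assms)
  from total_computable_left[OF this] show ?thesis unfolding h by simp
qed

lemma total_computable_Tuple:
  assumes "total_computable (\<lambda>p n. encode (C p n))" "total_computable (\<lambda>p n. encode (D p n))"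
  shows "total_computable (\<lambda>p n. encode (Tuple (C p n) (D p n)))"
  by (simp only: encode.simps) (intro total_computable_intros assms)

lemma total_computable_Comp:
  assumes "total_computable (\<lambda>p n. encode (C p n))" "total_computable (\<lambda>p n. encode (D p n))"
  shows "total_computable (\<lambda>p n. encode (Comp (C p n) (D p n)))"
  by (simp only: encode.simps) (intro total_computable_intros assms)

lemma total_computable_encode_decode:
  assumes "total_computable F"
  shows "total_computable (\<lambda>p n. encode (decode (F p n)))"
  using assms by simp

text \<open>Joining two functionals is a uniform syntactic construction too. Both programs are run on
  every \<open>n\<close> before one result is selected; this is harmless as long as both are total.\<close>

lemma ex_join_code:
  obtains J where
    "\<And>c d p f g. functional c p = Some f \<Longrightarrow> functional d p = Some g \<Longrightarrow>
       functional (J c d) p = Some (join f g)"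
    "\<And>C D. total_computable (\<lambda>p n. encode (C p n)) \<Longrightarrow>
       total_computable (\<lambda>p n. encode (D p n)) \<Longrightarrow>
       total_computable (\<lambda>p n. encode (J (C p n) (D p n)))"
proof -
  let ?sel = "\<lambda>x. if left x mod 2 = 0 then left (right x) else right (right x)"
  have "total_computable (\<lambda>p. ?sel)" "total_computable (\<lambda>p n. n div 2)"
    by (intro total_computable_intros)+
  then obtain sel half where
    ev: "\<And>p n. eval sel p n = Some (?sel n)" "\<And>p n. eval half p n = Some (n div 2)"
    unfolding total_computable_iff_eval by blast
  let ?J = "\<lambda>c d. Comp sel (Tuple (Tuple First Second) (Tuple (Comp c half) (Comp d half)))"
  show ?thesis
  proof (rule that[of ?J])
    show "functional (?J c d) p = Some (join f g)"
      if "functional c p = Some f" "functional d p = Some g" for c d p f g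
      using that by (simp add: functional_eq_Some_iff ev join_eq_if_mod)
    show "total_computable (\<lambda>p n. encode (?J (C p n) (D p n)))"
      if "total_computable (\<lambda>p n. encode (C p n))" "total_computable (\<lambda>p n. encode (D p n))" for C D
      by (intro total_computable_Comp total_computable_Tuple that total_computable_const)
  qed
qed

section \<open>The jump on Baire space\<close>

lemma tot_jump_at_nonempty: "tot_jump_at F e i p \<noteq> {}"
  by (auto simp: tot_jump_at_def mdom_def)

lemma ex_prepend2: "\<exists>e i p. r = prepend e (prepend i p)"
  by (metis prepend_head_tail)

lemma mdom_tot_jump_baire: "mdom (tot_jump_baire F) = UNIV"
proof -
  have "tot_jump_baire F r \<noteq> {}" for r
    using ex_prepend2[of r] tot_jump_at_nonempty by fastforce
  then show ?thesis by (simp add: mdom_def)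
qed

lemma tot_jump_at_eq:
  assumes "Phi e p = Some p'" "p' \<in> mdom F" "\<And>q. q \<in> F p' \<Longrightarrow> Phi i (join p q) = Some (h q)"
  shows "tot_jump_at F e i p = h ` F p'"
proof -
  have "tot_jump_at F e i p = {the (Phi i (join p q)) | q. q \<in> F p'}"
    using assms by (simp add: tot_jump_at_def)
  also have "\<dots> = h ` F p'" using assms(3) by (force simp: image_def)
  finally show ?thesis .
qed

lemma total_computable_even_part: "total_computable (\<lambda>r n. r (2 * n))"
  by (intro total_computable_intros)

lemma total_computable_odd_part: "total_computable (\<lambda>r n. r (Suc (2 * n)))"
  by (intro total_computable_intros)

lemma weihrauch_baire_tot_jump: "weihrauch_baire F (tot_jump_baire F)"
proof -
  obtain e where e: "Phi e p = Some p" for p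
    using total_computable_imp_Phi[OF total_computable_oracle[OF total_computable_id]] by auto
  obtain i where i: "Phi i r = Some (\<lambda>n. r (Suc (2 * n)))" for r
    using total_computable_imp_Phi[OF total_computable_odd_part] by auto
  have "total_computable (\<lambda>p. prepend e (prepend i p))"
    by (intro total_computable_prepend total_computable_const
        total_computable_oracle[OF total_computable_id])
  then have *: "computable_functional (\<lambda>p. Some (prepend e (prepend i p)))"
    by (simp add: total_computable_def)
  have **: "computable_functional (Phi i)" using computable_functional_iff_Phi by blast
  have "tot_jump_at F e i p = F p" if "p \<in> mdom F" for p
    using tot_jump_at_eq[OF e that, of i "\<lambda>q. q"] by (simp add: i)
  then show ?thesis unfolding weihrauch_baire_def
    by (intro exI[of _ "\<lambda>p. Some (prepend e (prepend i p))"] exI[of _ "Phi i"] conjI * **)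
      (simp add: i mdom_tot_jump_baire)
qed

text \<open>The diagonal argument. The function \<open>double\<close> rebuilds the triple \<open>(e, i, p)\<close> from a
  sequence \<open>p\<close> that starts with \<open>e\<close> and \<open>i\<close>, and the programs \<open>e\<close> and \<open>i\<close> run the given
  reduction on the triple rebuilt from their own input.\<close>

lemma not_weihrauch_baire_tot_jump: "\<not> weihrauch_baire (tot_jump_baire F) F"
proof
  assume "weihrauch_baire (tot_jump_baire F) F"
  then obtain c d where cd: "\<And>r. \<exists>r'. functional c r = Some r' \<and> r' \<in> mdom F \<and>
      (\<forall>q\<in>F r'. \<exists>s. functional d (join r q) = Some s \<and> s \<in> tot_jump_baire F r)"
    unfolding weihrauch_baire_def computable_functional_def mdom_tot_jump_baire by blast
  define double where "double p = prepend (p 0) (prepend (p 1) p)" for p :: baire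
  have *: "total_computable double" unfolding double_def
    by (intro total_computable_prepend total_computable_intros)
  have **: "total_computable (\<lambda>r. join (double (\<lambda>n. r (2 * n))) (\<lambda>n. r (Suc (2 * n))))"
    unfolding double_def
    by (intro total_computable_join total_computable_prepend total_computable_intros)
  obtain a b where a: "\<And>p. functional a p = Some (double p)" and
    b: "\<And>p q. functional b (join p q) = Some (join (double p) q)"
  proof -
    obtain a b where ab: "\<And>p. functional a p = Some (double p)"
      "\<And>r. functional b r = Some (join (double (\<lambda>n. r (2 * n))) (\<lambda>n. r (Suc (2 * n))))"
      using * ** unfolding total_computable_iff_eval functional_eq_Some_iff by blast
    show ?thesis by (rule that[of a b]) (simp_all add: ab)
  qed
  define e i where "e = encode (osubst a c)" and "i = encode (Comp Succ (osubst b d))"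
  \<comment> \<open>the tail of \<open>p\<close> is arbitrary\<close>
  define p where "p = prepend e (prepend i (\<lambda>_. 0))"
  let ?r = "prepend e (prepend i p)"
  have r: "double p = ?r" by (simp add: double_def p_def)
  obtain r' where r': "functional c ?r = Some r'" "r' \<in> mdom F" and
    d: "\<And>q. q \<in> F r' \<Longrightarrow> \<exists>s. functional d (join ?r q) = Some s \<and> s \<in> tot_jump_at F e i p"
    using cd[of ?r] by auto
  then obtain s where s: "\<And>q. q \<in> F r' \<Longrightarrow> functional d (join ?r q) = Some (s q)"
    "\<And>q. q \<in> F r' \<Longrightarrow> s q \<in> tot_jump_at F e i p" by metis
  have "Phi e p = Some r'"
    unfolding Phi_def e_def using a[of p] r'(1) by (simp add: functional_osubst r)
  moreover have "Phi i (join p q) = Some (\<lambda>n. Suc (s q n))" if "q \<in> F r'" for q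
    unfolding Phi_def i_def decode_encode using b[of p q] s(1)[OF that]
    by (intro functional_Comp_Succ) (simp add: functional_osubst r)
  ultimately have jump: "tot_jump_at F e i p = (\<lambda>q n. Suc (s q n)) ` F r'"
    using r'(2) by (intro tot_jump_at_eq) auto
  obtain q0 where "q0 \<in> F r'" using r'(2) by (auto simp: mdom_def)
  then obtain q where q: "q \<in> F r'" and min: "\<And>q'. q' \<in> F r' \<Longrightarrow> s q 0 \<le> s q' 0"
    using ex_has_least_nat[of "\<lambda>q. q \<in> F r'" q0 "\<lambda>q. s q 0"] by blast
  obtain q' where "q' \<in> F r'" "s q = (\<lambda>n. Suc (s q' n))" using s(2)[OF q] jump by auto
  with min[of q'] show False by simp
qed

text \<open>Below, \<open>E e\<close> and \<open>I e i\<close> are the indices \<open>e'\<close> and \<open>i'\<close>. In \<open>I e i\<close>, the innermost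
  substitution lets \<open>\<Phi>\<^sub>e\<close> see only the left half \<open>p\<close> of the oracle \<open>(p, q)\<close>; joining with the
  right half gives the oracle \<open>(\<Phi>\<^sub>e(p), q)\<close> for \<open>\<Psi>\<close>, and joining \<open>p\<close> with the result gives the
  oracle for \<open>\<Phi>\<^sub>i\<close>.\<close>

lemma weihrauch_baire_tot_jump_mono:
  assumes "weihrauch_baire F G"
  shows "weihrauch_baire (tot_jump_baire F) (tot_jump_baire G)"
proof -
  obtain c d where cd: "\<And>p. p \<in> mdom F \<Longrightarrow> \<exists>p'. functional c p = Some p' \<and> p' \<in> mdom G \<and>
      (\<forall>q\<in>G p'. \<exists>r. functional d (join p q) = Some r \<and> r \<in> F p)"
    using assms unfolding weihrauch_baire_def computable_functional_def by blast
  obtain J where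
    J: "\<And>c d p f g. functional c p = Some f \<Longrightarrow> functional d p = Some g \<Longrightarrow>
       functional (J c d) p = Some (join f g)" and
    J_computable: "\<And>C D. total_computable (\<lambda>p n. encode (C p n)) \<Longrightarrow>
       total_computable (\<lambda>p n. encode (D p n)) \<Longrightarrow>
       total_computable (\<lambda>p n. encode (J (C p n) (D p n)))"
    using ex_join_code by blast
  obtain L R where L: "\<And>p q. functional L (join p q) = Some p"
    and R: "\<And>p q. functional R (join p q) = Some q" and
    snd: "\<And>p q. Phi (encode R) (join p q) = Some q"
  proof -
    obtain L R where LR: "\<And>r. functional L r = Some (\<lambda>n. r (2 * n))"
      "\<And>r. functional R r = Some (\<lambda>n. r (Suc (2 * n)))"
      using total_computable_even_part total_computable_odd_part
      unfolding total_computable_def computable_functional_def fun_eq_iff by metis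
    show ?thesis by (rule that[of L R]) (simp_all add: Phi_def LR)
  qed
  define E where "E e = encode (osubst (decode e) c)" for e
  define I where "I e i = encode (osubst (J L (osubst (J (osubst L (decode e)) R) d)) (decode i))"
    for e i
  define T where "T r = prepend (E (r 0)) (prepend (I (r 0) (r 1)) (\<lambda>n. r (Suc (Suc n))))"
    for r :: baire
  have T_prepend: "T (prepend e (prepend i p)) = prepend (E e) (prepend (I e i) p)" for e i p
    by (simp add: T_def)
  have "total_computable T" unfolding T_def E_def I_def
    by (intro total_computable_prepend total_computable_osubst J_computable
        total_computable_encode_decode total_computable_intros)
  then have T: "computable_functional (\<lambda>r. Some (T r))" by (simp add: total_computable_def)
  have sub: "tot_jump_at G (E e) (I e i) p \<subseteq> tot_jump_at F e i p" for e i p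
  proof (cases "\<exists>p'. Phi e p = Some p' \<and> p' \<in> mdom F \<and> (\<forall>q\<in>F p'. Phi i (join p q) \<noteq> None)")
    case True
    then obtain p' where p': "Phi e p = Some p'" "p' \<in> mdom F" and
      "\<forall>q\<in>F p'. Phi i (join p q) \<noteq> None" by blast
    then obtain h where h: "\<And>q. q \<in> F p' \<Longrightarrow> Phi i (join p q) = Some (h q)"
      using that[of "\<lambda>q. the (Phi i (join p q))"] by auto
    obtain p'' where p'': "functional c p' = Some p''" "p'' \<in> mdom G" and
      "\<forall>q\<in>G p''. \<exists>r. functional d (join p' q) = Some r \<and> r \<in> F p'" using cd[OF p'(2)] by blast
    then obtain k where k: "\<And>q. q \<in> G p'' \<Longrightarrow> functional d (join p' q) = Some (k q)"
      "\<And>q. q \<in> G p'' \<Longrightarrow> k q \<in> F p'" by metis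
    have "Phi (E e) p = Some p''"
      using p'(1) p''(1) by (simp add: Phi_def E_def functional_osubst)
    moreover have "Phi (I e i) (join p q) = Some (h (k q))" if q: "q \<in> G p''" for q
    proof -
      have "functional (osubst L (decode e)) (join p q) = Some p'"
        using p'(1) by (simp add: Phi_def functional_osubst[OF L])
      from functional_osubst[OF J[OF this R], of d]
      have "functional (osubst (J (osubst L (decode e)) R) d) (join p q) = Some (k q)"
        by (simp add: k(1)[OF q])
      from functional_osubst[OF J[OF L this], of "decode i"] show ?thesis
        using h[OF k(2)[OF q]] by (simp add: I_def Phi_def)
    qed
    ultimately have "tot_jump_at G (E e) (I e i) p = (\<lambda>q. h (k q)) ` G p''"
      using p''(2) by (intro tot_jump_at_eq) auto
    also have "\<dots> \<subseteq> h ` F p'" using k(2) by auto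
    also have "\<dots> = tot_jump_at F e i p" using tot_jump_at_eq[OF p' h] by simp
    finally show ?thesis .
  next
    case False
    then have "tot_jump_at F e i p = UNIV" unfolding tot_jump_at_def by (rule if_not_P)
    then show ?thesis by simp
  qed
  have "tot_jump_baire G (T r) \<subseteq> tot_jump_baire F r" for r
  proof -
    obtain e i p where "r = prepend e (prepend i p)" using ex_prepend2 by blast
    then show ?thesis using sub by (simp add: T_prepend)
  qed
  moreover have "computable_functional (Phi (encode R))"
    using computable_functional_iff_Phi by blast
  ultimately show ?thesis unfolding weihrauch_baire_def
    by (intro exI[of _ "\<lambda>r. Some (T r)"] exI[of _ "Phi (encode R)"] conjI T)
      (auto simp: snd mdom_tot_jump_baire)
qed

section \<open>The jump on problems\<close>

lemma realizer_tot_jump: "realizer (tot_jump f) = tot_jump_baire (realizer f)"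
  by (simp add: tot_jump_def realizer_baire_problem)

theorem theorem3p4:
  "(\<forall>f :: ('a, 'b) problem. is_problem f \<longrightarrow> f <\<^sub>W tot_jump f) \<and>
   (\<forall>(f :: ('c, 'd) problem) (g :: ('e, 'h) problem).
      is_problem f \<longrightarrow> is_problem g \<longrightarrow> f \<le>\<^sub>W g \<longrightarrow> tot_jump f \<le>\<^sub>W tot_jump g)"
  by (simp add: weihrauch_less_def weihrauch_le_def realizer_tot_jump weihrauch_baire_tot_jump
      not_weihrauch_baire_tot_jump weihrauch_baire_tot_jump_mono)

end
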